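(* Let $d\in\mathbb{N}$, $d\geq2$, and let $\beta\in(1,2)$ be the $d$-Bonacci number. Let $\mathcal{P}$ denote the set of non-zero $x\in\mathbb{Z}[\beta]\cap X_S$ such that $T_S^p x=x$ for some $p\geq1$. Then $$\mathcal{P}\cup\{0\}=\Bigl\{\pm\sum_{i=2}^d p_i\beta^{-i} : p_i\in\{0,1\}\Bigr\}.$$
   Context: The $d$-Bonacci number is the Pisot number $\beta\in(1,2)$ satisfying $\beta^d=\beta^{d-1}+\dots+\beta+1$. $X_S=[-\tfrac12,\tfrac\beta2-1)\cup[1-\tfrac\beta2,\tfrac12)$ and $T_S\colon X_S\to X_S$, $T_S(x)=\beta x-\lfloor\beta x-\tfrac12\rfloor$.
   Formalization: The transformation is taken as T_S(x) = βx − ⌊βx + 1/2⌋; with the printed −1/2 inside the floor all values lie in [1/2, 3/2), outside X_S, so there would be no periodic points and the claim would fail. *)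

theory Defs
  imports Complex_Main "HOL-Computational_Algebra.Computational_Algebra"
begin

text \<open>The monic irreducible integer polynomial below is the minimal polynomial of \<open>\<beta>\<close>,
  so its complex roots are the Galois conjugates of \<open>\<beta>\<close>.\<close>

definition is_pisot :: "real \<Rightarrow> bool" where
  "is_pisot \<beta> \<longleftrightarrow> \<beta> > 1 \<and>
     (\<exists>m :: int poly. lead_coeff m = 1 \<and> irreducible m \<and> poly (map_poly of_int m) \<beta> = 0 \<and>
        (\<forall>z :: complex. poly (map_poly of_int m) z = 0 \<and> z \<noteq> of_real \<beta> \<longrightarrow> norm z < 1))"

definition is_dbonacci :: "nat \<Rightarrow> real \<Rightarrow> bool" where
  "is_dbonacci d \<beta> \<longleftrightarrow> is_pisot \<beta> \<and> 1 < \<beta> \<and> \<beta> < 2 \<and> \<beta> ^ d = (\<Sum>i<d. \<beta> ^ i)"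

definition int_adjoin :: "real \<Rightarrow> real set" where
  "int_adjoin \<beta> = {poly (map_poly of_int q) \<beta> | q :: int poly. True}"

definition X_S :: "real \<Rightarrow> real set" where
  "X_S \<beta> = {-1/2 ..< \<beta>/2 - 1} \<union> {1 - \<beta>/2 ..< 1/2}"

text \<open>The shift inside the floor has to be \<open>+1/2\<close>: with \<open>-1/2\<close> all values would lie in
  \<open>[1/2, 3/2)\<close>, outside \<open>X_S \<beta>\<close>. Lemma \<open>T_S_in_X_S\<close> confirms that \<open>T_S \<beta>\<close> is a self-map
  of \<open>X_S \<beta>\<close>.\<close>

definition T_S :: "real \<Rightarrow> real \<Rightarrow> real" where
  "T_S \<beta> x = \<beta> * x - of_int \<lfloor>\<beta> * x + 1/2\<rfloor>"

lemma T_S_in_X_S: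
  assumes \<beta>: "1 < \<beta>" "\<beta> < 2" and x: "x \<in> X_S \<beta>"
  shows "T_S \<beta> x \<in> X_S \<beta>"
proof -
  from x consider (neg) "-1/2 \<le> x" "x < \<beta>/2 - 1" | (pos) "1 - \<beta>/2 \<le> x" "x < 1/2"
    by (auto simp: X_S_def)
  then show ?thesis
  proof cases
    case neg
    have lo: "- \<beta>/2 \<le> \<beta> * x"
      using mult_left_mono[OF neg(1), of \<beta>] \<beta> by simp
    have hi: "\<beta> * x \<le> x"
      using mult_right_mono_neg[of 1 \<beta> x] neg \<beta> by simp
    show ?thesis
    proof (cases "\<beta> * x < -1/2")
      case True
      then have "\<lfloor>\<beta> * x + 1/2\<rfloor> = -1"
        using lo \<beta> by linarith
      then have "T_S \<beta> x = \<beta> * x + 1" by (simp add: T_S_def)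
      then show ?thesis using True lo unfolding X_S_def Un_iff atLeastLessThan_iff by linarith
    next
      case False
      then have "\<lfloor>\<beta> * x + 1/2\<rfloor> = 0"
        using hi neg \<beta> by linarith
      then have "T_S \<beta> x = \<beta> * x" by (simp add: T_S_def)
      then show ?thesis using False hi neg unfolding X_S_def Un_iff atLeastLessThan_iff by linarith
    qed
  next
    case pos
    have hi: "\<beta> * x < \<beta>/2"
      using mult_strict_left_mono[OF pos(2), of \<beta>] \<beta> by simp
    have lo: "x \<le> \<beta> * x"
      using mult_right_mono[of 1 \<beta> x] pos \<beta> by simp
    show ?thesis
    proof (cases "\<beta> * x < 1/2")
      case True
      then have "\<lfloor>\<beta> * x + 1/2\<rfloor> = 0"
        using lo pos \<beta> by linarith
      then have "T_S \<beta> x = \<beta> * x" by (simp add: T_S_def)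
      then show ?thesis using True lo pos unfolding X_S_def Un_iff atLeastLessThan_iff by linarith
    next
      case False
      then have "\<lfloor>\<beta> * x + 1/2\<rfloor> = 1"
        using hi \<beta> by linarith
      then have "T_S \<beta> x = \<beta> * x - 1" by (simp add: T_S_def)
      then show ?thesis using False hi unfolding X_S_def Un_iff atLeastLessThan_iff by linarith
    qed
  qed
qed

definition periodic_points :: "real \<Rightarrow> real set" where
  "periodic_points \<beta> =
     {x \<in> int_adjoin \<beta> \<inter> X_S \<beta>. x \<noteq> 0 \<and> (\<exists>p\<ge>1. (T_S \<beta> ^^ p) x = x)}"

end

theory Submission
  imports Defs
begin

text \<open>
  Put \<open>b\<^sub>n = 1\<close> if \<open>T_S\<^sup>n x < 0\<close> and \<open>b\<^sub>n = 0\<close> otherwise. Non-zero digits of \<open>T_S\<close> alternate in sign, so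
  the \<open>n\<close>-th digit is \<open>b\<^sub>n\<^sub>+\<^sub>1 - b\<^sub>n\<close>. If \<open>b\<close> has period \<open>d\<close>, then
  \<open>x = \<Sum>\<^sub>j\<^sub><\<^sub>d b\<^sub>j \<beta>\<^bsup>-j-1\<^esup> - b\<^sub>0\<close>, on such numbers \<open>T_S\<close> merely rotates \<open>b\<close>, and they are exactly the
  signed digit sums. It remains to see that \<open>b\<close> has period \<open>d\<close> for every periodic
  \<open>x \<in> \<int>[\<beta>]\<close>. In suitable integer coordinates the orbit becomes a sequence \<open>e\<close> with
  \<open>e\<^sub>n\<^sub>+\<^sub>d = e\<^sub>n + \<dots> + e\<^sub>n\<^sub>+\<^sub>d\<^sub>-\<^sub>1 - (b\<^sub>n\<^sub>+\<^sub>1 - b\<^sub>n)\<close>. It is eventually periodic, because \<open>e\<^sub>n\<^sub>+\<^sub>P - e\<^sub>n\<close> solves the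
  homogeneous recurrence with zero real coordinate, hence each of its terms is a weighted mean of
  the previous \<open>d\<close> ones, which forces an integer sequence to vanish eventually. With \<open>F\<close> the
  partial sums of \<open>e\<close>, the periodic sequence \<open>V\<^sub>n\<^sub>+\<^sub>d = 2 F\<^sub>n\<^sub>+\<^sub>d + b\<^sub>n\<close> satisfies
  \<open>V\<^sub>n\<^sub>+\<^sub>d = \<lceil>V\<^sub>n\<^sub>+\<^sub>d\<^sub>+\<^sub>1 / 2\<rceil> + \<lfloor>V\<^sub>n / 2\<rfloor>\<close>, and a maximum principle shows that \<open>V\<close> has period \<open>d\<close>.
\<close>

section \<open>Periodic integer sequences and the maximum principle\<close>

lemma periodic_mult:
  fixes V :: "nat \<Rightarrow> 'a"
  assumes "\<And>n. V (n + P) = V n"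
  shows "V (n + k * P) = V n"
proof (induction k)
  case (Suc k)
  have "V (n + Suc k * P) = V ((n + k * P) + P)" by (simp add: algebra_simps)
  then show ?case using assms Suc by simp
qed simp

lemma periodic_attains_Max:
  fixes V :: "nat \<Rightarrow> int"
  assumes "P \<ge> 1" "\<And>n. V (n + P) = V n"
  obtains k where "\<And>n. V n \<le> V k"
proof -
  have eq: "V n = V (n mod P)" for n
    using periodic_mult[of V P "n mod P" "n div P"] assms(2) by (simp add: add.commute)
  let ?S = "V ` {..<P}"
  have ne: "?S \<noteq> {}" "finite ?S" using assms(1) by (auto simp: lessThan_empty_iff)
  obtain k where k: "V k = Max ?S" using Max_in[OF ne(2,1)] by force
  have "V n \<le> V k" for n
  proof -
    have "V (n mod P) \<in> ?S" using assms(1) by auto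
    then show ?thesis using k ne eq[of n] by simp
  qed
  then show ?thesis by (rule that)
qed

text \<open>If the maximum \<open>T\<close> of \<open>V\<close> is odd, attaining it propagates from \<open>n\<close> to \<open>n + 1\<close>, so \<open>V\<close> is
  constant. If \<open>T\<close> is even, attaining it propagates from \<open>n + d\<close> to \<open>n\<close>, and then
  \<open>V \<ge> T - 1\<close> propagates everywhere.\<close>
lemma balanced_recurrence_periodic:
  fixes V :: "nat \<Rightarrow> int"
  assumes P: "P \<ge> 1" and per: "\<And>n. V (n + P) = V n"
    and rec: "\<And>n. V (n + d) = (V (n + d + 1) + 1) div 2 + V n div 2"
  shows "V (n + d) = V n"
proof -
  obtain k where k: "\<And>n. V n \<le> V k" using periodic_attains_Max[of P V] P per by blast
  define T where "T = V k"
  have le: "V n \<le> T" for n using k T_def by simp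
  have perm: "V (n + i * P) = V n" for n i using periodic_mult per by blast
  have from_tail: "Q (V n)" if "\<And>n. n \<ge> N \<Longrightarrow> Q (V n)" for Q N n
  proof -
    have "N \<le> n + N * P" using P by (simp add: trans_le_add2)
    then show ?thesis using that perm by metis
  qed
  show ?thesis
  proof (cases "odd T")
    case True
    \<comment> \<open>With T = 2a + 1 the summand \<open>V n div 2\<close> is at most a, so the
      other one is at least a + 1, which lifts \<open>V (n + d + 1)\<close> to T.\<close>
    have step: "V (n + d + 1) = T" if "V (n + d) = T" for n
    proof -
      obtain a where a: "T = 2 * a + 1" using True by (elim oddE)
      have "V n div 2 \<le> a" using zdiv_mono1[OF le[of n], of 2] unfolding a by simp
      then show ?thesis using rec[of n] le[of "n + d + 1"] that unfolding a by linarith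
    qed
    have "V (k + d * P + i) = T" for i
    proof (induction i)
      case 0
      then show ?case using perm T_def by simp
    next
      case (Suc i)
      have "d \<le> k + d * P + i" using P by (simp add: trans_le_add2 trans_le_add1)
      then obtain m where "k + d * P + i = m + d" by (metis add.commute le_Suc_ex)
      then show ?case using step[of m] Suc by (simp add: add_ac)
    qed
    then have "V n = T" if "n \<ge> k + d * P" for n using that by (metis le_iff_add)
    then have "V n = T" for n using from_tail[of "k + d * P" "\<lambda>v. v = T"] by blast
    then show ?thesis by simp
  next
    case False
    then obtain a where a: "T = 2 * a" by blast
    \<comment> \<open>Both summands are at most a = T / 2, so the value T at n + d makes both equal
      to a.\<close>
    have pull: "V n = T" if "V (n + d) = T" for n
    proof -
      have "(V (n + d + 1) + 1) div 2 \<le> a"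
        using zdiv_mono1[of "V (n + d + 1) + 1" "T + 1" 2] le[of "n + d + 1"] unfolding a by simp
      then show ?thesis using rec[of n] le[of n] that unfolding a by linarith
    qed
    have pulls: "V n = T" if "V (n + i * d) = T" for n i
      using that
    proof (induction i)
      case (Suc i)
      then show ?case using pull[of "n + i * d"] by (simp add: algebra_simps)
    qed simp
    \<comment> \<open>Since d * P is a period, P - 1 backward steps of length d from n + d * P end
      at n + d: backward propagation also yields forward propagation.\<close>
    have forth: "V (n + d) = T" if "V n = T" for n
    proof (rule pulls[of "n + d" "P - 1"])
      have "n + d + (P - 1) * d = n + d * P" using P by (cases P) (auto simp: algebra_simps)
      then show "V (n + d + (P - 1) * d) = T" using perm that by metis
    qed
    have forths: "V (n + i * d) = T" if "V n = T" for n i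
    proof (induction i)
      case 0
      then show ?case using that by simp
    next
      case (Suc i)
      then show ?case using forth[of "n + i * d"] by (simp add: algebra_simps)
    qed
    have eqd: "V (n + d) = V n" if "V n \<ge> T - 1" "V (n + d) \<ge> T - 1" for n
      using that pull[of n] forth[of n] le[of n] le[of "n + d"] by linarith
    \<comment> \<open>\<open>V n\<close> is 2a or 2a - 1 and equals \<open>V (n + d)\<close>. In
      both cases \<open>V n - V n div 2\<close> is a, which bounds \<open>V (n + d + 1)\<close>
      below by 2a - 1.\<close>
    have next': "V (n + d + 1) \<ge> T - 1" if "V n \<ge> T - 1" "V (n + d) \<ge> T - 1" for n
    proof -
      have "V n = 2 * a \<or> V n = 2 * a - 1" using that le[of n] unfolding a by linarith
      moreover have "(2 * a - 1) div 2 = a - 1" by presburger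
      ultimately show ?thesis using rec[of n] eqd[OF that] unfolding a by auto
    qed
    have "\<forall>j. V (k + i + j * d) \<ge> T - 1" for i
    proof (induction i)
      case 0
      then show ?case using forths[of k] T_def by simp
    next
      case (Suc i)
      \<comment> \<open>\<open>next'\<close> reaches only the offsets \<open>Suc j * d\<close>; the
        offset 0 is recovered afterwards by shifting by the period d * P.\<close>
      have *: "V (k + Suc i + Suc j * d) \<ge> T - 1" for j
      proof -
        have "V (k + i + j * d) \<ge> T - 1" "V (k + i + j * d + d) \<ge> T - 1"
          using Suc[rule_format, of j] Suc[rule_format, of "Suc j"] by (auto simp: algebra_simps)
        from next'[OF this] show ?thesis by (simp add: algebra_simps)
      qed
      show ?case
      proof
        fix j
        obtain Q where Q: "P = Suc Q" using P by (cases P) auto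
        have "k + Suc i + j * d + d * P = k + Suc i + Suc (j + Q) * d"
          unfolding Q by (simp add: algebra_simps)
        then have "V (k + Suc i + j * d) = V (k + Suc i + Suc (j + Q) * d)"
          using perm[of "k + Suc i + j * d" d] by metis
        then show "V (k + Suc i + j * d) \<ge> T - 1" using *[of "j + Q"] by simp
      qed
    qed
    then have "V (k + i) \<ge> T - 1" for i by (metis add.right_neutral mult_0)
    then have "V n \<ge> T - 1" if "n \<ge> k" for n using that by (metis le_iff_add)
    then have "V n \<ge> T - 1" for n using from_tail[of k "\<lambda>v. v \<ge> T - 1"] by blast
    then show ?thesis using eqd by blast
  qed
qed

section \<open>Arithmetic in \<int>[\<beta>]\<close>

lemma map_poly_of_int_add:
  "map_poly of_int (p + q) = map_poly of_int p + (map_poly of_int q :: real poly)"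
  by (intro poly_eqI) (simp add: coeff_map_poly)

lemma map_poly_of_int_smult:
  "map_poly of_int (smult a q) = smult (of_int a) (map_poly of_int q :: real poly)"
  by (intro poly_eqI) (simp add: coeff_map_poly)

lemma map_poly_of_int_mult:
  "map_poly of_int (p * q) = map_poly of_int p * (map_poly of_int q :: real poly)"
  by (induction p) (simp_all add: map_poly_of_int_add map_poly_of_int_smult map_poly_pCons)

lemma int_adjoin_of_int: "of_int k \<in> int_adjoin \<beta>"
  unfolding int_adjoin_def by (auto intro!: exI[of _ "[:k:]"] simp: map_poly_pCons)

lemma int_adjoin_beta: "\<beta> \<in> int_adjoin \<beta>"
  unfolding int_adjoin_def by (auto intro!: exI[of _ "[:0, 1:]"] simp: map_poly_pCons)

lemma int_adjoin_add: "x \<in> int_adjoin \<beta> \<Longrightarrow> y \<in> int_adjoin \<beta> \<Longrightarrow> x + y \<in> int_adjoin \<beta>"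
  unfolding int_adjoin_def by clarsimp (metis map_poly_of_int_add poly_add)

lemma int_adjoin_mult: "x \<in> int_adjoin \<beta> \<Longrightarrow> y \<in> int_adjoin \<beta> \<Longrightarrow> x * y \<in> int_adjoin \<beta>"
  unfolding int_adjoin_def by clarsimp (metis map_poly_of_int_mult poly_mult)

lemma int_adjoin_power: "x \<in> int_adjoin \<beta> \<Longrightarrow> x ^ n \<in> int_adjoin \<beta>"
  by (induction n) (use int_adjoin_of_int[of 1] int_adjoin_mult in auto)

lemma int_adjoin_sum: "(\<And>i. i \<in> A \<Longrightarrow> f i \<in> int_adjoin \<beta>) \<Longrightarrow> sum f A \<in> int_adjoin \<beta>"
  by (induction A rule: infinite_finite_induct)
    (use int_adjoin_of_int[of 0] int_adjoin_add in auto)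

section \<open>Powers of 1 / \<beta> and the real coordinate of the recurrence\<close>

locale dbonacci =
  fixes d :: nat and \<beta> :: real
  assumes d2: "d \<ge> 2" and b1: "1 < \<beta>" and b2: "\<beta> < 2" and root: "\<beta> ^ d = (\<Sum>i<d. \<beta> ^ i)"
begin

definition u :: real where "u = 1 / \<beta>"

text \<open>The weights of a left eigenvector, for the eigenvalue \<beta>, of the companion matrix
  of \<open>e (n + d) = e n + ... + e (n + d - 1)\<close>, scaled so that
  \<open>s (d - 1) = 1\<close>.\<close>

definition s :: "nat \<Rightarrow> real" where "s j = (\<Sum>i<Suc j. u ^ Suc i)"

text \<open>The coordinates are chosen such that multiplication by \<open>\<beta>\<close> shifts \<open>e\<close> by one place, see \<open>L_Suc\<close>.\<close>
definition L :: "(nat \<Rightarrow> int) \<Rightarrow> nat \<Rightarrow> real" where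
  "L e n = (\<Sum>j<d. s j * of_int (e (n + j)))"

text \<open>For b of period d this is the closed form of the series with terms
  \<open>(b (n + k + 1) - b (n + k)) * u ^ Suc k\<close>, because 1 - u^d = \<beta> - 1.\<close>

definition X :: "(nat \<Rightarrow> int) \<Rightarrow> nat \<Rightarrow> real" where
  "X b n = (\<Sum>j<d. u ^ Suc j * of_int (b (n + j))) - of_int (b n)"

lemma u_bounds: "1/2 < u" "u < 1" "0 < u" "\<beta> * u = 1"
  using b1 b2 by (auto simp: u_def field_simps)

lemma beta_u_Suc: "\<beta> * u ^ Suc i = u ^ i"
  using u_bounds(4) by (simp add: mult.assoc[symmetric])

lemma sum_u: "(\<Sum>i<d. u ^ Suc i) = 1"
proof -
  have "\<beta> ^ d * u ^ Suc i = \<beta> ^ (d - Suc i)" if "i < d" for i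
    using that b1 by (simp add: u_def power_divide power_diff del: power_Suc)
  then have "\<beta> ^ d * (\<Sum>i<d. u ^ Suc i) = (\<Sum>i<d. \<beta> ^ (d - Suc i))"
    by (simp add: sum_distrib_left del: power_Suc)
  also have "\<dots> = \<beta> ^ d" using root by (simp add: sum.nat_diff_reindex)
  finally show ?thesis using b1 by simp
qed

lemma u_power_d: "u ^ d = 2 - \<beta>"
proof -
  have "\<beta> ^ d - 1 = (\<beta> - 1) * \<beta> ^ d" using power_diff_1_eq[of \<beta> d] root by simp
  then have "(2 - \<beta>) * \<beta> ^ d = 1" by (simp add: algebra_simps)
  then show ?thesis using b1 by (simp add: u_def power_divide field_simps)
qed

lemma s_0: "s 0 = u" by (simp add: s_def)
lemma s_Suc: "s (Suc j) = s j + u ^ Suc (Suc j)" by (simp add: s_def)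
lemma s_pos: "s j > 0"
  unfolding s_def by (rule sum_pos) (use u_bounds in auto)
lemma s_last: "s (d - 1) = 1"
  using sum_u d2 by (simp add: s_def del: power_Suc sum.lessThan_Suc)
lemma beta_s_Suc: "\<beta> * s (Suc j) = 1 + s j"
  unfolding s_def sum.lessThan_Suc_shift[of _ "Suc j"]
  using u_bounds(4) by (simp add: distrib_left sum_distrib_left beta_u_Suc mult.assoc[symmetric] del: sum.lessThan_Suc)

lemma L_Suc:
  assumes "e (n + d) = (\<Sum>j<d. e (n + j)) - c"
  shows "L e (Suc n) = \<beta> * L e n - of_int c"
proof -
  obtain k where k: "d = Suc k" using d2 by (cases d) auto
  have sk: "s k = 1" using s_last k by simp
  have L: "L e m = (\<Sum>j<Suc k. s j * of_int (e (m + j)))" for m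
    unfolding k[symmetric] by (rule L_def)
  have "\<beta> * L e n = (\<Sum>j<Suc k. (\<beta> * s j) * of_int (e (n + j)))"
    by (simp add: L sum_distrib_left mult.assoc del: sum.lessThan_Suc)
  also have "\<dots> = of_int (e n) + (\<Sum>j<k. (1 + s j) * of_int (e (Suc n + j)))"
    unfolding sum.lessThan_Suc_shift using u_bounds(4) by (simp add: s_0 beta_s_Suc)
  also have "\<dots> = of_int (\<Sum>j<d. e (n + j)) + (\<Sum>j<k. s j * of_int (e (Suc n + j)))"
    unfolding k sum.lessThan_Suc_shift by (simp add: algebra_simps sum.distrib)
  finally have "\<beta> * L e n = of_int (e (n + d) + c) + (\<Sum>j<k. s j * of_int (e (Suc n + j)))"
    using assms by simp
  moreover have "L e (Suc n) = (\<Sum>j<k. s j * of_int (e (Suc n + j))) + of_int (e (n + d))"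
    using sk unfolding L by (simp add: k)
  ultimately show ?thesis by simp
qed

text \<open>Summation by parts: consecutive weights differ by a power of u and the last weight is 1.
  A vanishing L thus gives a mean value property, and for b of period d the left side becomes
  \<open>- X b n\<close>.\<close>

lemma L_diff_Suc:
  "L e (Suc n) - L e n = of_int (e (n + d)) - (\<Sum>j<d. u ^ Suc j * of_int (e (n + j)))"
proof -
  obtain k where k: "d = Suc k" using d2 by (cases d) auto
  have sk: "s k = 1" using s_last k by simp
  have L: "L e m = (\<Sum>j<Suc k. s j * of_int (e (m + j)))" for m
    unfolding k[symmetric] by (rule L_def)
  have "L e n = u * of_int (e n) + (\<Sum>j<k. (s j + u ^ Suc (Suc j)) * of_int (e (Suc n + j)))"
    unfolding L sum.lessThan_Suc_shift by (simp add: s_0 s_Suc)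
  moreover have "(\<Sum>j<d. u ^ Suc j * of_int (e (n + j)))
      = u * of_int (e n) + (\<Sum>j<k. u ^ Suc (Suc j) * of_int (e (Suc n + j)))"
    unfolding k sum.lessThan_Suc_shift by simp
  moreover have "L e (Suc n) = (\<Sum>j<k. s j * of_int (e (Suc n + j))) + of_int (e (n + d))"
    using sk unfolding L by (simp add: k)
  ultimately show ?thesis by (simp add: sum.distrib distrib_right)
qed

text \<open>The means keep e bounded, so by integrality its limit superior B is attained arbitrarily
  late. A mean with positive weights that attains its upper bound B has all d entries equal to B;
  then L = 0 with positive weights s gives B = 0, and d consecutive zeros persist.\<close>

lemma L_zero_imp_eventually_zero:
  assumes L0: "\<And>n. L e n = 0"
  obtains N where "\<And>n. n \<ge> N \<Longrightarrow> e n = 0"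
proof -
  have avg: "of_int (e (n + d)) = (\<Sum>j<d. u ^ Suc j * of_int (e (n + j)))" for n
    using L_diff_Suc[of e n] L0 by simp
  have upper: "e (n + d) \<le> B" if "\<And>j. j < d \<Longrightarrow> e (n + j) \<le> B" for n B
  proof -
    have "of_int (e (n + d)) \<le> (\<Sum>j<d. u ^ Suc j * real_of_int B)"
      unfolding avg by (intro sum_mono mult_left_mono) (use that u_bounds in auto)
    also have "\<dots> = of_int B" unfolding sum_distrib_right[symmetric] sum_u by simp
    finally show ?thesis by simp
  qed
  have lower: "e (n + d) \<ge> B" if "\<And>j. j < d \<Longrightarrow> e (n + j) \<ge> B" for n B
  proof -
    have "(\<Sum>j<d. u ^ Suc j * real_of_int B) \<le> of_int (e (n + d))"
      unfolding avg by (intro sum_mono mult_left_mono) (use that u_bounds in auto)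
    moreover have "(\<Sum>j<d. u ^ Suc j * real_of_int B) = of_int B"
      unfolding sum_distrib_right[symmetric] sum_u by simp
    ultimately show ?thesis by simp
  qed
  define K where "K = Max ((\<lambda>j. \<bar>e j\<bar>) ` {..<d})"
  have K: "\<bar>e j\<bar> \<le> K" if "j < d" for j unfolding K_def using that by (intro Max_ge) auto
  have bd: "- K \<le> e n \<and> e n \<le> K" for n
  proof (induction n rule: less_induct)
    case (less n)
    show ?case
    proof (cases "n < d")
      case True
      then show ?thesis using K[of n] by linarith
    next
      case False
      then have "n = (n - d) + d" "\<And>j. j < d \<Longrightarrow> n - d + j < n" by auto
      then show ?thesis using lower[of "-K" "n - d"] upper[of "n - d" K] less by (metis)
    qed
  qed
  \<comment> \<open>\<open>int m - K\<close> is the limit superior of \<open>e\<close>.\<close>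
  define Q where "Q m \<longleftrightarrow> (\<exists>N. \<forall>n\<ge>N. e n \<le> int m - K)" for m
  have K0: "K \<ge> 0" using bd[of 0] by linarith
  have "Q (nat (2 * K))" unfolding Q_def using bd K0 by simp
  define m where "m = (LEAST m. Q m)"
  have "Q m" unfolding m_def by (rule LeastI) fact
  have least: "\<not> Q k" if "k < m" for k using not_less_Least that unfolding m_def by blast
  from \<open>Q m\<close> obtain N where N: "\<And>n. n \<ge> N \<Longrightarrow> e n \<le> int m - K" unfolding Q_def by blast
  have "\<exists>n\<ge>N + d. e n \<ge> int m - K"
  proof (rule ccontr)
    assume c: "\<not> ?thesis"
    then have m0: "m > 0" using bd[of "N + d"] by (cases "m = 0") (auto simp: not_le)
    have "e n \<le> int (m - 1) - K" if "n \<ge> N + d" for n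
    proof -
      have "e n < int m - K" using c that by (meson not_le)
      then show ?thesis using m0 by (simp add: of_nat_diff)
    qed
    then have "Q (m - 1)" unfolding Q_def by blast
    then show False using least m0 by simp
  qed
  then obtain n where n: "n \<ge> N + d" "e n \<ge> int m - K" by blast
  define B where "B = int m - K"
  define n' where "n' = n - d"
  have n': "n' \<ge> N" "n = n' + d" using n by (auto simp: n'_def)
  have leB: "e (n' + j) \<le> B" for j using N n' B_def by simp
  have eB: "e (n' + d) = B" using leB[of d] n n' B_def by simp
  have win: "e (n' + j) = B" if j: "j < d" for j
  proof (rule ccontr)
    assume "e (n' + j) \<noteq> B"
    then have lt: "e (n' + j) < B" using leB[of j] by simp
    have "of_int (e (n' + d)) < (\<Sum>j<d. u ^ Suc j * real_of_int B)"
      unfolding avg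
      by (rule sum_strict_mono_ex1) (use leB lt j u_bounds in \<open>auto intro!: mult_left_mono bexI[of _ j]\<close>)
    also have "\<dots> = of_int B" unfolding sum_distrib_right[symmetric] sum_u by simp
    finally show False using eB by simp
  qed
  have "0 = (\<Sum>j<d. s j * real_of_int B)" using L0[of n'] win by (simp add: L_def)
  also have "\<dots> = (\<Sum>j<d. s j) * of_int B" by (simp add: sum_distrib_right)
  finally have B0: "B = 0" using sum_pos[of "{..<d}" s] s_pos d2 by (auto simp: lessThan_empty_iff)
  have "e (n' + i) = 0" for i
  proof (induction i rule: less_induct)
    case (less i)
    show ?case
    proof (cases "i < d")
      case True
      then show ?thesis using win B0 by simp
    next
      case False
      then have "i = (i - d) + d" by simp
      moreover have "e (n' + (i - d) + j) = 0" if "j < d" for j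
        using less[of "i - d + j"] False that by (simp add: add.assoc)
      then have "of_int (e (n' + (i - d) + d)) = (0::real)" unfolding avg by simp
      ultimately show ?thesis by (simp add: add.assoc)
    qed
  qed
  then have "e n = 0" if "n \<ge> n'" for n using that by (metis le_iff_add)
  then show ?thesis by (rule that)
qed


section \<open>Elements of \<int>[\<beta>] as initial values of recurrences\<close>

lemma int_adjoin_imp_L:
  assumes "x \<in> int_adjoin \<beta>"
  obtains e where "x = L e 0"
proof -
  obtain q :: "int poly" where q: "x = poly (map_poly of_int q) \<beta>"
    using assms by (auto simp: int_adjoin_def)
  have "\<exists>e. poly (map_poly of_int q) \<beta> = L e 0"
  proof (induction q)
    case 0
    show ?case by (rule exI[of _ "\<lambda>_. 0"]) (simp add: L_def)
  next
    case (pCons a q)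
    then obtain e where e: "poly (map_poly of_int q) \<beta> = L e 0" by blast
    \<comment> \<open>Horner step: appending this term and shifting the window multiplies the
      coordinate by \<beta> and adds a.\<close>
    define f where "f = e(d := (\<Sum>j<d. e j) + a)"
    have "f (0 + d) = (\<Sum>j<d. f (0 + j)) - (- a)" by (simp add: f_def)
    from L_Suc[OF this] have "L f (Suc 0) = \<beta> * L f 0 + of_int a" by simp
    moreover have "L f 0 = L e 0" by (simp add: L_def f_def)
    moreover have "L f (Suc 0) = L (\<lambda>n. f (Suc n)) 0" by (simp add: L_def)
    ultimately have "poly (map_poly of_int (pCons a q)) \<beta> = L (\<lambda>n. f (Suc n)) 0"
      using e by (simp add: map_poly_pCons)
    then show ?case by blast
  qed
  then show ?thesis using q that by blast
qed

text \<open>The first \<open>d\<close> entries of \<open>window a c n\<close> are the terms \<open>n, \<dots>, n + d - 1\<close> of the recurrence with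
  initial values \<open>a\<close> and inhomogeneity \<open>c\<close>; the other entries are meaningless.\<close>
primrec window :: "(nat \<Rightarrow> int) \<Rightarrow> (nat \<Rightarrow> int) \<Rightarrow> nat \<Rightarrow> nat \<Rightarrow> int" where
  "window a c 0 = a"
| "window a c (Suc n) = (\<lambda>j. if j = d - 1 then (\<Sum>i<d. window a c n i) - c n
     else window a c n (Suc j))"

lemma recurrence_solution:
  obtains e where "L e 0 = L a 0" "\<And>n. e (n + d) = (\<Sum>j<d. e (n + j)) - c n"
proof -
  define e where "e n = window a c n 0" for n
  have w: "window a c n j = e (n + j)" if "j < d" for n j
    using that
  proof (induction j arbitrary: n)
    case (Suc j)
    then have "j \<noteq> d - 1" by simp
    then show ?case using Suc.IH[of "Suc n"] Suc.prems by simp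
  qed (simp add: e_def)
  have "L e 0 = L a 0" using w[of _ 0] by (simp add: L_def)
  moreover have "e (n + d) = (\<Sum>j<d. e (n + j)) - c n" for n
    using w[of "d - 1" "Suc n"] w[of _ n] d2 by simp
  ultimately show ?thesis by (rule that)
qed

section \<open>Periodic points have sign sequences of period d\<close>

lemma T_S_digit:
  assumes "-1/2 \<le> x" "x < 1/2" "x \<noteq> 0"
  shows "\<lfloor>\<beta> * x + 1/2\<rfloor> = of_bool (T_S \<beta> x < 0) - of_bool (x < 0)"
proof (cases "x < 0")
  case True
  have 1: "- \<beta>/2 \<le> \<beta> * x" using mult_left_mono[OF assms(1), of \<beta>] b1 by simp
  have 2: "\<beta> * x < 0" using True b1 by (simp add: mult_pos_neg)
  show ?thesis
  \<comment> \<open>The digit -1 leads to a point that is at least 1 - \<beta>/2 > 0, so the sign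
    flips exactly when the digit is non-zero.\<close>
  proof (cases "\<beta> * x < -1/2")
    case c: True
    then have "\<lfloor>\<beta> * x + 1/2\<rfloor> = -1" using 1 b2 by linarith
    then show ?thesis using True 1 b2 by (simp add: T_S_def)
  next
    case False
    then have "\<lfloor>\<beta> * x + 1/2\<rfloor> = 0" using 2 by linarith
    then show ?thesis using True 2 by (simp add: T_S_def)
  qed
next
  case False
  then have x: "x > 0" using assms by simp
  have 1: "\<beta> * x < \<beta>/2" using mult_strict_left_mono[OF assms(2), of \<beta>] b1 by simp
  have 2: "\<beta> * x > 0" using x b1 by simp
  show ?thesis
  proof (cases "\<beta> * x < 1/2")
    case True
    then have "\<lfloor>\<beta> * x + 1/2\<rfloor> = 0" using 2 by linarith
    then show ?thesis using False 2 by (simp add: T_S_def)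
  next
    case c: False
    then have "\<lfloor>\<beta> * x + 1/2\<rfloor> = 1" using 1 b2 by linarith
    then show ?thesis using False 1 b2 by (simp add: T_S_def)
  qed
qed

lemma periodic_recurrence_solution:
  fixes e b :: "nat \<Rightarrow> int"
  assumes P: "P \<ge> 1" and eP: "\<And>n. e (n + P) = e n" and bP: "\<And>n. b (n + P) = b n"
    and b01: "\<And>n. b n \<in> {0, 1}"
    and rec: "\<And>n. e (n + d) = (\<Sum>j<d. e (n + j)) - (b (n + 1) - b n)"
  shows "e n = b n - b (n + 1)" "b (n + d) = b n"
proof -
  define F where "F n = (\<Sum>k<n. e k)" for n
  have F_Suc: "F (Suc n) = F n + e n" for n by (simp add: F_def)
  have F_diff: "(\<Sum>j<k. e (n + j)) = F (n + k) - F n" for n k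
    by (induction k) (auto simp: F_Suc)
  have F_P: "F (n + P) = F n + F P" for n
    by (induction n) (auto simp: F_Suc eP F_def[of 0])
  \<comment> \<open>A summed form of the recurrence. Comparing n = 0 with n = P gives (d - 1) * F P
    = 0, so the partial sums F are themselves periodic.\<close>
  have inv: "F (n + d) - (\<Sum>j<d. F (n + j)) + b n = F d - (\<Sum>j<d. F j) + b 0" for n
  proof (induction n)
    case (Suc n)
    have "(\<Sum>j<d. F (Suc n + j)) = (\<Sum>j<d. F (n + j)) + (\<Sum>j<d. e (n + j))"
      by (simp add: F_Suc sum.distrib)
    then show ?case using Suc rec[of n] F_Suc[of "n + d"] by simp
  qed simp
  have "F (P + d) = F d + F P" using F_P[of d] by (simp add: add.commute)
  moreover have "(\<Sum>j<d. F (P + j)) = (\<Sum>j<d. F j) + int d * F P"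
    using F_P by (simp add: add.commute sum.distrib)
  ultimately have "(int d - 1) * F P = 0" using inv[of P] bP[of 0] by (simp add: algebra_simps)
  then have "F P = 0" using d2 by auto
  then have F_per: "F (n + P) = F n" for n using F_P by simp
  \<comment> \<open>This is b delayed by d: since d * P is a period, adding (P - 1) * d acts as
    subtracting d, and V is defined at indices below d as well.\<close>
  define b' where "b' n = b (n + (P - 1) * d)" for n
  have b'_shift: "b' (n + d) = b n" for n
  proof -
    have "n + d + (P - 1) * d = n + d * P" using P by (cases P) (auto simp: algebra_simps)
    then show ?thesis unfolding b'_def using periodic_mult[of b P n d] bP by metis
  qed
  have b'_per: "b' (n + P) = b' n" for n
    unfolding b'_def using bP[of "n + (P - 1) * d"] by (simp add: algebra_simps)
  have b'01: "b' n \<in> {0, 1}" for n unfolding b'_def by (rule b01)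
  define V where "V n = 2 * F n + b' n" for n
  have V_per: "V (n + P) = V n" for n by (simp add: V_def F_per b'_per)
  have div2: "V n div 2 = F n" "(V n + 1) div 2 = F n + b' n" for n
    using b'01[of n] by (auto simp: V_def)
  have V_rec: "V (n + d) = (V (n + d + 1) + 1) div 2 + V n div 2" for n
    using rec[of n] F_diff[of n d] F_Suc[of "n + d"] b'_shift[of n] b'_shift[of "n + 1"]
    unfolding div2 by (simp add: V_def)
  have V_d: "V (n + d) = V n" for n
    using balanced_recurrence_periodic[of P V d n] P V_per V_rec by blast
  have F_d: "F (n + d) = F n" for n using V_d[of n] div2(1) by metis
  have "b' (n + d) = b' n" for n using V_d[of n] F_d[of n] by (simp add: V_def)
  then show "b (n + d) = b n" using b'_shift by metis
  have "e (n + d) = e n" using F_d[of n] F_d[of "Suc n"] F_Suc[of n] F_Suc[of "n + d"] by simp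
  then show "e n = b n - b (n + 1)" using rec[of n] F_diff[of n d] F_d[of n] by simp
qed

lemma periodic_point_eq_X:
  assumes x: "x \<in> int_adjoin \<beta>" "x \<in> X_S \<beta>" "x \<noteq> 0" and P: "P \<ge> 1" "(T_S \<beta> ^^ P) x = x"
  obtains b where "\<And>n. b n \<in> {0, 1}" "x = X b 0"
proof -
  define xs where "xs n = (T_S \<beta> ^^ n) x" for n
  have xs_Suc: "xs (Suc n) = T_S \<beta> (xs n)" for n by (simp add: xs_def)
  have xs_P: "xs (n + P) = xs n" for n using P by (simp add: xs_def funpow_add)
  have "xs n \<in> X_S \<beta>" for n
    by (induction n) (use x T_S_in_X_S b1 b2 in \<open>auto simp: xs_def\<close>)
  then have range: "-1/2 \<le> xs n" "xs n < 1/2" for n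
    using b1 b2 unfolding X_S_def by (smt (verit) Un_iff atLeastLessThan_iff field_sum_of_halves)+
  have nz: "xs n \<noteq> 0" for n
  proof
    assume *: "xs n = 0"
    have "xs (n + k) = 0" for k by (induction k) (auto simp: * xs_Suc T_S_def)
    moreover have "n + (n * P - n) = 0 + n * P" using P(1) by simp
    ultimately have "xs (0 + n * P) = 0" by metis
    then show False using periodic_mult[of xs P 0 n] xs_P x(3) by (simp add: xs_def)
  qed
  define b :: "nat \<Rightarrow> int" where "b n = of_bool (xs n < 0)" for n
  have b01: "b n \<in> {0, 1}" for n by (simp add: b_def)
  have bP: "b (n + P) = b n" for n by (simp add: b_def xs_P)
  define c where "c n = b (n + 1) - b n" for n
  have xs_rec: "xs (Suc n) = \<beta> * xs n - of_int (c n)" for n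
    using T_S_digit[OF range nz, of n] by (simp add: xs_Suc T_S_def c_def b_def)
  obtain a where a: "x = L a 0" using int_adjoin_imp_L[OF x(1)] .
  obtain e where e: "L e 0 = L a 0" "\<And>n. e (n + d) = (\<Sum>j<d. e (n + j)) - c n"
    using recurrence_solution[of a c] by blast
  have Le: "L e n = xs n" for n
  proof (induction n)
    case 0
    then show ?case using e a by (simp add: xs_def)
  next
    case (Suc n)
    then show ?case using L_Suc[OF e(2)[of n]] xs_rec by simp
  qed
  have "L (\<lambda>n. e (n + P) - e n) n = L e (n + P) - L e n" for n
    by (simp add: L_def sum_subtractf right_diff_distrib add_ac)
  then have "L (\<lambda>n. e (n + P) - e n) n = 0" for n by (simp add: Le xs_P)
  then obtain N where N: "\<And>n. n \<ge> N \<Longrightarrow> e (n + P) - e n = 0"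
    using L_zero_imp_eventually_zero[of "\<lambda>n. e (n + P) - e n"] by blast
  \<comment> \<open>Shifting by a multiple of P drops the preperiod of e but changes neither b nor
    the orbit.\<close>
  define f where "f n = e (n + N * P)" for n
  have NP: "N \<le> N * P" using P by simp
  have fP: "f (n + P) = f n" for n
    using N[of "n + N * P"] NP by (simp add: f_def add_ac trans_le_add1)
  have bN: "b (n + N * P) = b n" for n using periodic_mult[of b P n N] bP by simp
  have f_rec: "f (n + d) = (\<Sum>j<d. f (n + j)) - (b (n + 1) - b n)" for n
    using e(2)[of "n + N * P"] bN[of n] bN[of "n + 1"] by (simp add: f_def c_def add_ac)
  have f_eq: "f n = b n - b (n + 1)" and b_d: "b (n + d) = b n" for n
    using periodic_recurrence_solution[of P f b n] P(1) fP bP b01 f_rec by blast+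
  have "x = xs (N * P)" using periodic_mult[of xs P 0 N] xs_P by (simp add: xs_def)
  also have "\<dots> = L f 0" by (simp add: Le[symmetric] L_def f_def add.commute)
  also have "\<dots> = L b 0 - L b (Suc 0)"
    by (simp add: L_def f_eq sum_subtractf right_diff_distrib)
  also have "\<dots> = X b 0" using L_diff_Suc[of b 0] b_d[of 0] by (simp add: X_def)
  finally show ?thesis using b01 that by blast
qed

section \<open>Rotation of b and signed digit sums\<close>

lemma X_Suc:
  assumes "b (n + d) = b n"
  shows "X b (Suc n) = \<beta> * X b n - of_int (b (Suc n) - b n)"
proof -
  obtain k where k: "d = Suc k" using d2 by (cases d) auto
  have "\<beta> * (\<Sum>j<d. u ^ Suc j * of_int (b (n + j))) = (\<Sum>j<d. u ^ j * of_int (b (n + j)))"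
    by (simp add: sum_distrib_left beta_u_Suc mult.assoc[symmetric] del: power_Suc)
  also have "\<dots> = of_int (b n) + (\<Sum>j<k. u ^ Suc j * of_int (b (Suc n + j)))"
    unfolding k sum.lessThan_Suc_shift by simp
  finally have 1: "\<beta> * (\<Sum>j<d. u ^ Suc j * of_int (b (n + j)))
    = of_int (b n) + (\<Sum>j<k. u ^ Suc j * of_int (b (Suc n + j)))" .
  have "(\<Sum>j<d. u ^ Suc j * of_int (b (Suc n + j)))
      = (\<Sum>j<k. u ^ Suc j * of_int (b (Suc n + j))) + u ^ d * of_int (b (n + d))"
    unfolding k by simp
  \<comment> \<open>The term b n that leaves the sum returns at its end with weight u^d = 2 -
    \<beta>, and this balances the correction \<open>- of_int (b n)\<close> in X.\<close>
  then show ?thesis using 1 unfolding X_def u_power_d assms by (simp add: algebra_simps)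
qed

lemma sum_split_first:
  fixes g :: "nat \<Rightarrow> real"
  shows "(\<Sum>j<d. u ^ Suc j * g j) = u * g 0 + (\<Sum>i=2..d. g (i - 1) / \<beta> ^ i)"
proof -
  have "(\<Sum>j<d. u ^ Suc j * g j) = (\<Sum>i=1..d. g (i - 1) / \<beta> ^ i)"
    by (rule sum.reindex_bij_witness[of _ "\<lambda>i. i - 1" Suc]) (auto simp: u_def power_divide)
  also have "\<dots> = u * g 0 + (\<Sum>i=2..d. g (i - 1) / \<beta> ^ i)"
    using d2 by (subst sum.atLeast_Suc_atMost) (auto simp: u_def numeral_2_eq_2)
  finally show ?thesis .
qed

lemma sum_ge_2: "(\<Sum>i=2..d. 1 / \<beta> ^ i) = 1 - u"
  using sum_split_first[of "\<lambda>_. 1"] sum_u by simp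

text \<open>For b 0 = 1 the identity u + ... + u^d = 1 turns the expression into minus the sum of
  the complementary digits.\<close>

lemma X_eq_signed_sum:
  assumes "b 0 \<in> {0, 1}"
  shows "X b 0 = (if b 0 = 0 then 1 else -1) *
    (\<Sum>i=2..d. (if b 0 = 0 then of_int (b (i - 1)) else 1 - of_int (b (i - 1))) / \<beta> ^ i)"
proof (cases "b 0 = 0")
  case True
  then show ?thesis using sum_split_first[of "\<lambda>i. of_int (b i)"] by (simp add: X_def)
next
  case False
  then have "b 0 = 1" using assms by simp
  moreover have "(\<Sum>i=2..d. (1 - of_int (b (i - 1))) / \<beta> ^ i)
      = 1 - u - (\<Sum>i=2..d. of_int (b (i - 1)) / \<beta> ^ i)"
    by (simp add: diff_divide_distrib sum_subtractf sum_ge_2)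
  ultimately show ?thesis using sum_split_first[of "\<lambda>i. of_int (b i)"] by (simp add: X_def)
qed

text \<open>A non-zero sum contains a power of u, each at least u^d = 2 - \<beta>, which exceeds the
  endpoint 1 - \<beta>/2 of \<open>X_S\<close>; the full sum is 1 - u < 1/2.\<close>

lemma digit_sum_bounds:
  assumes p: "\<And>i. i \<in> {2..d} \<Longrightarrow> p i \<in> {0, 1::real}"
  defines "v \<equiv> (\<Sum>i=2..d. p i / \<beta> ^ i)"
  shows "v = 0 \<or> 2 - \<beta> \<le> v" "0 \<le> v" "v < 1/2"
proof -
  have nonneg: "0 \<le> p i / \<beta> ^ i" if "i \<in> {2..d}" for i
    using p[OF that] b1 by auto
  then show "0 \<le> v" unfolding v_def by (rule sum_nonneg)
  have "v \<le> (\<Sum>i=2..d. 1 / \<beta> ^ i)"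
    unfolding v_def by (rule sum_mono) (use p b1 in \<open>fastforce simp: divide_le_cancel\<close>)
  then show "v < 1/2" using sum_ge_2 u_bounds by simp
  show "v = 0 \<or> 2 - \<beta> \<le> v"
  proof (cases "\<exists>i\<in>{2..d}. p i = 1")
    case True
    then obtain i where i: "i \<in> {2..d}" "p i = 1" by blast
    have "2 - \<beta> = u ^ d" by (simp add: u_power_d)
    also have "\<dots> \<le> u ^ i" using i u_bounds by (intro power_decreasing) auto
    also have "\<dots> = p i / \<beta> ^ i" using i by (simp add: u_def power_divide)
    also have "\<dots> \<le> v" unfolding v_def by (rule member_le_sum) (use i nonneg in auto)
    finally show ?thesis by simp
  next
    case False
    then have "p i = 0" if "i \<in> {2..d}" for i using p that by blast
    then show ?thesis by (simp add: v_def)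
  qed
qed

lemma X_abs_less:
  assumes b01: "\<And>n. b n \<in> {0, 1}"
  shows "\<bar>X b n\<bar> < 1/2"
proof -
  define b' where "b' j = b (n + j)" for j
  have eq: "X b n = X b' 0" by (simp add: X_def b'_def)
  have 01: "b' j \<in> {0, 1}" for j using b01 by (simp add: b'_def)
  define p where "p i = (if b' 0 = 0 then of_int (b' (i - 1)) else 1 - real_of_int (b' (i - 1)))" for i
  have "p i \<in> {0, 1}" for i using 01[of "i - 1"] by (auto simp: p_def)
  then have "0 \<le> (\<Sum>i=2..d. p i / \<beta> ^ i)" "(\<Sum>i=2..d. p i / \<beta> ^ i) < 1/2"
    using digit_sum_bounds[of p] by blast+
  moreover have "X b' 0 = (if b' 0 = 0 then 1 else -1) * (\<Sum>i=2..d. p i / \<beta> ^ i)"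
    unfolding p_def by (rule X_eq_signed_sum[of b', OF 01])
  ultimately show ?thesis using eq by (simp split: if_splits)
qed

lemma T_S_X:
  assumes "\<And>n. b n \<in> {0, 1}" "b (n + d) = b n"
  shows "T_S \<beta> (X b n) = X b (Suc n)"
proof -
  have eq: "\<beta> * X b n = X b (Suc n) + of_int (b (Suc n) - b n)"
    using X_Suc[OF assms(2)] by simp
  have "\<bar>X b (Suc n)\<bar> < 1/2" using assms(1) by (rule X_abs_less)
  then have "\<lfloor>\<beta> * X b n + 1/2\<rfloor> = b (Suc n) - b n"
    unfolding eq by linarith
  then show ?thesis unfolding T_S_def eq by simp
qed

text \<open>\<beta> is a unit, since its defining polynomial has constant term -1.\<close>

lemma int_adjoin_u: "u \<in> int_adjoin \<beta>"
proof -
  obtain k where k: "d = Suc k" using d2 by (cases d) auto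
  have "\<beta> * \<beta> ^ k = 1 + \<beta> * (\<Sum>i<k. \<beta> ^ i)"
    using root unfolding k sum.lessThan_Suc_shift by (simp add: sum_distrib_left)
  then have "1 = \<beta> * (\<beta> ^ k + (-1) * (\<Sum>i<k. \<beta> ^ i))" by (simp add: algebra_simps)
  then have "u = \<beta> ^ k + of_int (-1) * (\<Sum>i<k. \<beta> ^ i)" using b1 by (simp add: u_def field_simps)
  also have "\<dots> \<in> int_adjoin \<beta>"
    by (intro int_adjoin_add int_adjoin_mult int_adjoin_sum int_adjoin_power int_adjoin_beta int_adjoin_of_int)
  finally show ?thesis .
qed

lemma signed_sum_in_periodic_points:
  assumes \<sigma>: "\<sigma> \<in> {1, -1}" and p: "\<And>i. i \<in> {2..d} \<Longrightarrow> p i \<in> {0, 1::real}"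
    and nz: "\<sigma> * (\<Sum>i=2..d. p i / \<beta> ^ i) \<noteq> 0"
  shows "\<sigma> * (\<Sum>i=2..d. p i / \<beta> ^ i) \<in> periodic_points \<beta>"
proof -
  define v where "v = (\<Sum>i=2..d. p i / \<beta> ^ i)"
  have v: "2 - \<beta> \<le> v" "0 \<le> v" "v < 1/2"
    using digit_sum_bounds[of p] p nz unfolding v_def by auto
  have inX: "\<sigma> * v \<in> X_S \<beta>"
    using \<sigma> v b1 b2 unfolding X_S_def by auto
  have "\<sigma> * v = (\<Sum>i=2..d. of_int (if p i = 0 then 0 else if \<sigma> = 1 then 1 else -1) * u ^ i)"
    unfolding v_def sum_distrib_left
    by (rule sum.cong) (use p \<sigma> in \<open>force simp: u_def power_divide\<close>)+
  also have "\<dots> \<in> int_adjoin \<beta>"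
    by (intro int_adjoin_sum int_adjoin_mult int_adjoin_power int_adjoin_u int_adjoin_of_int)
  finally have inZ: "\<sigma> * v \<in> int_adjoin \<beta>" .
  \<comment> \<open>Inverts \<open>X_eq_signed_sum\<close>: b 0 encodes the sign, later entries are
    the digits p shifted by one index, complemented if \<sigma> = -1.\<close>
  define b :: "nat \<Rightarrow> int" where
    "b n = of_bool (if n mod d = 0 \<or> p (Suc (n mod d)) = 0 then \<sigma> = -1 else \<sigma> = 1)" for n
  have b01: "b n \<in> {0, 1}" for n by (simp add: b_def)
  have b_d: "b (n + d) = b n" for n by (simp add: b_def)
  have b0: "b 0 = 0 \<longleftrightarrow> \<sigma> = 1" using \<sigma> by (auto simp: b_def)
  have bi: "(if b 0 = 0 then of_int (b (i - 1)) else 1 - of_int (b (i - 1))) = p i"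
    if "i \<in> {2..d}" for i
  proof -
    have "(i - 1) mod d = i - 1" "i - 1 \<noteq> 0" "Suc (i - 1) = i" using that by auto
    then show ?thesis unfolding b0 using \<sigma> p[OF that] by (auto simp: b_def)
  qed
  have "X b 0 = (if b 0 = 0 then 1 else -1) * v"
    unfolding X_eq_signed_sum[OF b01] v_def using bi by simp
  then have X0: "X b 0 = \<sigma> * v" using b0 \<sigma> by auto
  have "(T_S \<beta> ^^ n) (X b 0) = X b n" for n
    by (induction n) (simp_all add: T_S_X[of b, OF b01 b_d])
  moreover have "X b d = X b 0" using b_d by (simp add: X_def add.commute[of d] b_d[of 0, simplified])
  ultimately have "(T_S \<beta> ^^ d) (\<sigma> * v) = \<sigma> * v" using X0 by metis
  then show ?thesis using inX inZ nz d2 unfolding periodic_points_def v_def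
    by (auto intro!: exI[of _ d])
qed

lemma periodic_point_in_signed_sums:
  assumes "x \<in> periodic_points \<beta>"
  obtains \<sigma> p where "\<sigma> \<in> {1, -1}" "\<And>i. p i \<in> {0, 1::real}" "x = \<sigma> * (\<Sum>i=2..d. p i / \<beta> ^ i)"
proof -
  obtain b where b: "\<And>n. b n \<in> {0, 1}" "x = X b 0"
    using periodic_point_eq_X[of x] assms unfolding periodic_points_def by blast
  show ?thesis
  proof (rule that)
    show "(if b 0 = 0 then of_int (b (i - 1)) else 1 - of_int (b (i - 1))) \<in> {0, 1::real}" for i
      using b(1)[of "i - 1"] by auto
    show "x = (if b 0 = 0 then 1 else -1) *
      (\<Sum>i=2..d. (if b 0 = 0 then of_int (b (i - 1)) else 1 - of_int (b (i - 1))) / \<beta> ^ i)"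
      using X_eq_signed_sum[OF b(1)] b(2) by simp
  qed simp
qed

end

theorem theorem3:
  fixes d :: nat and \<beta> :: real
  assumes "d \<ge> 2" and "is_dbonacci d \<beta>"
  shows "periodic_points \<beta> \<union> {0} =
    {\<sigma> * (\<Sum>i=2..d. p i / \<beta> ^ i) | (\<sigma> :: real) (p :: nat \<Rightarrow> real).
      \<sigma> \<in> {1, -1} \<and> (\<forall>i\<in>{2..d}. p i \<in> {0, 1})}" (is "_ = ?R")
proof -
  interpret dbonacci d \<beta>
    using assms unfolding dbonacci_def is_dbonacci_def by blast
  have "x \<in> ?R" if x: "x \<in> periodic_points \<beta>" for x
  proof -
    obtain \<sigma> p where "\<sigma> \<in> {1, -1}" "\<And>i. p i \<in> {0, 1::real}" "x = \<sigma> * (\<Sum>i=2..d. p i / \<beta> ^ i)"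
      using x by (rule periodic_point_in_signed_sums) blast
    then show ?thesis by (intro CollectI exI[of _ \<sigma>] exI[of _ p]) simp
  qed
  moreover have "0 \<in> ?R" by (intro CollectI exI[of _ 1] exI[of _ "\<lambda>_. 0"]) simp
  moreover have "x \<in> periodic_points \<beta> \<union> {0}" if "x \<in> ?R" for x
    using that signed_sum_in_periodic_points by blast
  ultimately show ?thesis by blast
qed

end
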